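(* Let $n\geq1$, $P_n=\{(i,j)\in[n]^2: i<j\}$ with $[n]=\{0,\ldots,n\}$, and $I\subset P_n$. Let $A_{I,n}$ be the set of total cyclic orders $\pi$ on $[n]$ such that $(i,i+1,\ldots,j)$ is a $\pi$-chain for every $(i,j)\in I$, and let $B_{I,n}=\{x\in[0,1]^n : x_{i+1}+\cdots+x_j\leq1 \text{ for all }(i,j)\in I\}$. Then \[ E^*(B_{I,n},z)=\sum_{\pi\in A_{I,n}} z^{\mathrm{des}(\underline{\pi})}. \]
   Context: A cyclic order on $X$ is a set $\pi\subset X^3$ with: (i) $(x,y,z)\in\pi\Rightarrow(y,z,x)\in\pi$; (ii) $(x,y,z)\in\pi\Rightarrow(z,y,x)\notin\pi$; (iii) $(x,y,z),(x,z,u)\in\pi\Rightarrow(x,y,u)\in\pi$; it is total if for all distinct $x,y,z$ either $(x,y,z)\in\pi$ or $(z,y,x)\in\pi$. For $m\geq3$, $(x_1,\ldots,x_m)$ (distinct elements) is a $\pi$-chain if $(x_1,x_i,x_{i+1})\in\pi$ for $2\leq i\leq m-1$; any pair of distinct elements is a $\pi$-chain. For a total cyclic order $\pi$ on $[n]$, $\underline{\pi}=(w_0,\ldots,w_n)$ is the unique word of distinct letters of $[n]$ with $w_0=0$ such that $(w_0,w_1,\ldots,w_n)$ is a $\pi$-chain (reading the elements around the circle clockwise starting from $0$). For such a word, $\mathrm{des}(\underline{w})$ is the number of positions $0\leq i\leq n-1$ with $w_{i+1}<w_i$. For a lattice polytope $P\subset\mathbb{R}^n$, $E(P,t)=\#(tP\cap\mathbb{Z}^n)$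 for integers $t\geq0$, and the Ehrhart $h^*$-polynomial is $E^*(P,z)=(1-z)^{n+1}\sum_{t\geq0}E(P,t)z^t$. *)

theory Defs
  imports Complex_Main "HOL-Library.FuncSet" "HOL-Computational_Algebra.Formal_Power_Series"
begin

definition cyclic_order_on :: "'a set \<Rightarrow> ('a \<times> 'a \<times> 'a) set \<Rightarrow> bool" where
  "cyclic_order_on X \<pi> \<longleftrightarrow>
     \<pi> \<subseteq> X \<times> X \<times> X \<and>
     (\<forall>x y z. (x, y, z) \<in> \<pi> \<longrightarrow> (y, z, x) \<in> \<pi>) \<and>
     (\<forall>x y z. (x, y, z) \<in> \<pi> \<longrightarrow> (z, y, x) \<notin> \<pi>) \<and>
     (\<forall>x y z u. (x, y, z) \<in> \<pi> \<and> (x, z, u) \<in> \<pi> \<longrightarrow> (x, y, u) \<in> \<pi>)"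

definition total_cyclic_order_on :: "'a set \<Rightarrow> ('a \<times> 'a \<times> 'a) set \<Rightarrow> bool" where
  "total_cyclic_order_on X \<pi> \<longleftrightarrow>
     cyclic_order_on X \<pi> \<and>
     (\<forall>x\<in>X. \<forall>y\<in>X. \<forall>z\<in>X. x \<noteq> y \<and> y \<noteq> z \<and> x \<noteq> z \<longrightarrow> (x, y, z) \<in> \<pi> \<or> (z, y, x) \<in> \<pi>)"

text \<open>For lists of length 2 the last condition is vacuous, so every pair of distinct
  elements is a chain.\<close>

definition cyclic_chain :: "'a set \<Rightarrow> ('a \<times> 'a \<times> 'a) set \<Rightarrow> 'a list \<Rightarrow> bool" where
  "cyclic_chain X \<pi> xs \<longleftrightarrow>
     2 \<le> length xs \<and> set xs \<subseteq> X \<and> distinct xs \<and>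
     (\<forall>i. 1 \<le> i \<and> i + 1 < length xs \<longrightarrow> (xs ! 0, xs ! i, xs ! (i + 1)) \<in> \<pi>)"

definition cyclic_word :: "nat \<Rightarrow> (nat \<times> nat \<times> nat) set \<Rightarrow> nat list" where
  "cyclic_word n \<pi> = (THE w. length w = n + 1 \<and> w ! 0 = 0 \<and> cyclic_chain {0..n} \<pi> w)"

definition des :: "nat list \<Rightarrow> nat" where
  "des w = card {i. i + 1 < length w \<and> w ! (i + 1) < w ! i}"

definition index_pairs :: "nat \<Rightarrow> (nat \<times> nat) set" where
  "index_pairs n = {(i, j). i \<in> {0..n} \<and> j \<in> {0..n} \<and> i < j}"

definition cyclic_orders_A :: "(nat \<times> nat) set \<Rightarrow> nat \<Rightarrow> (nat \<times> nat \<times> nat) set set" where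
  "cyclic_orders_A I n =
     {\<pi>. total_cyclic_order_on {0..n} \<pi> \<and> (\<forall>(i, j)\<in>I. cyclic_chain {0..n} \<pi> [i..<j + 1])}"

text \<open>Euclidean \<open>n\<close>-space, with \<open>n\<close> a term, is represented by the extensional functions
  \<open>{1..n} \<rightarrow>\<^sub>E UNIV\<close>; the lattice of integer points is then \<open>{1..n} \<rightarrow>\<^sub>E \<int>\<close>.\<close>

definition polytope_B :: "(nat \<times> nat) set \<Rightarrow> nat \<Rightarrow> (nat \<Rightarrow> real) set" where
  "polytope_B I n =
     {x \<in> {1..n} \<rightarrow>\<^sub>E {0..1}. \<forall>(i, j)\<in>I. (\<Sum>k=i+1..j. x k) \<le> 1}"

definition dilate :: "nat \<Rightarrow> nat \<Rightarrow> (nat \<Rightarrow> real) set \<Rightarrow> (nat \<Rightarrow> real) set" where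
  "dilate n t P = (\<lambda>x. \<lambda>k\<in>{1..n}. real t * x k) ` P"

definition ehrhart :: "nat \<Rightarrow> (nat \<Rightarrow> real) set \<Rightarrow> nat \<Rightarrow> nat" where
  "ehrhart n P t = card (dilate n t P \<inter> ({1..n} \<rightarrow>\<^sub>E \<int>))"

definition ehrhart_hstar :: "nat \<Rightarrow> (nat \<Rightarrow> real) set \<Rightarrow> int fps" where
  "ehrhart_hstar n P = (1 - fps_X) ^ (n + 1) * Abs_fps (\<lambda>t. int (ehrhart n P t))"

end

theory Submission
  imports Defs "HOL-Library.Product_Lexorder"
begin

text \<open>A lattice point \<open>x\<close> of \<open>t [0,1]\<^sup>n\<close> is a walk \<open>f k = (x 1 + \<dots> + x k) mod (t + 1)\<close> on a circle;
  \<open>t + 1\<close> points are needed to keep the steps \<open>0, \<dots>, t\<close> apart. Ordering the times \<open>0, \<dots>, n\<close>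
  lexicographically by \<open>(f k, k)\<close> and closing up gives a total cyclic order \<open>\<pi>\<close>, and
  \<open>x (i + 1) + \<dots> + x j \<le> t\<close> says that the walk does not come full circle between times \<open>i\<close>
  and \<open>j\<close>, i.e. that \<open>i, \<dots>, j\<close> is a \<open>\<pi>\<close>-chain. The walks that give a fixed \<open>\<pi>\<close> with word \<open>w\<close>
  are the sequences \<open>0 = f (w 0) \<le> \<dots> \<le> f (w n) \<le> t\<close> that are strict at the descents of \<open>w\<close>, and
  these have generating function \<open>z ^ des w / (1 - z) ^ (n + 1)\<close>.\<close>

section \<open>Sorted lists\<close>

lemma sorted_wrt_snoc:
  assumes "transp R" "xs \<noteq> []"
  shows "sorted_wrt R (xs @ [y]) \<longleftrightarrow> sorted_wrt R xs \<and> R (last xs) y"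
  using assms by (simp add: successively_append_iff flip: successively_conv_sorted_wrt)

lemma sorted_wrt_map_nth_less_iff:
  fixes p :: "'a \<Rightarrow> 'b::linorder"
  assumes "sorted_wrt (<) (map p w)" "i < length w" "j < length w"
  shows "p (w ! i) < p (w ! j) \<longleftrightarrow> i < j"
  using sorted_wrt_nth_less[OF assms(1), of i j] sorted_wrt_nth_less[OF assms(1), of j i] assms
  by (cases i j rule: linorder_cases) auto

lemma sorted_wrt_map_le_last:
  fixes p :: "'a \<Rightarrow> 'b::linorder"
  assumes "sorted_wrt (<) (map p w)" "x \<in> set w"
  shows "p x \<le> p (last w)"
  using assms by (cases w rule: rev_cases) (auto simp: sorted_wrt_append)

section \<open>Cyclic orders induced by keys\<close>

definition cyclic_order_of :: "'a set \<Rightarrow> ('a \<Rightarrow> 'b::linorder) \<Rightarrow> ('a \<times> 'a \<times> 'a) set" where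
  "cyclic_order_of X p = {(x, y, z). x \<in> X \<and> y \<in> X \<and> z \<in> X \<and>
     (p x < p y \<and> p y < p z \<or> p y < p z \<and> p z < p x \<or> p z < p x \<and> p x < p y)}"

lemma total_cyclic_order_on_cyclic_order_of:
  assumes "inj_on p X"
  shows "total_cyclic_order_on X (cyclic_order_of X p)"
proof -
  have "p x \<noteq> p y" if "x \<in> X" "y \<in> X" "x \<noteq> y" for x y
    using assms that by (auto dest: inj_onD)
  then have "\<forall>x\<in>X. \<forall>y\<in>X. \<forall>z\<in>X. x \<noteq> y \<and> y \<noteq> z \<and> x \<noteq> z \<longrightarrow>
      (x, y, z) \<in> cyclic_order_of X p \<or> (z, y, x) \<in> cyclic_order_of X p"
    unfolding cyclic_order_of_def by simp (metis linorder_neqE)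
  moreover have "cyclic_order_on X (cyclic_order_of X p)"
    unfolding cyclic_order_on_def cyclic_order_of_def by (intro conjI) auto
  ultimately show ?thesis
    by (simp add: total_cyclic_order_on_def)
qed

lemma cyclic_order_of_cong:
  assumes "\<And>x y. x \<in> X \<Longrightarrow> y \<in> X \<Longrightarrow> p x < p y \<longleftrightarrow> q x < q y"
  shows "cyclic_order_of X p = cyclic_order_of X q"
  using assms by (auto simp: cyclic_order_of_def)

lemma cyclic_order_of_eqI_sorted:
  assumes "sorted_wrt (<) (map p w)" "sorted_wrt (<) (map q w)"
  shows "cyclic_order_of (set w) p = cyclic_order_of (set w) q"
proof (rule cyclic_order_of_cong)
  fix x y assume "x \<in> set w" "y \<in> set w"
  then obtain i j where "i < length w" "j < length w" "x = w ! i" "y = w ! j"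
    by (metis in_set_conv_nth)
  then show "p x < p y \<longleftrightarrow> q x < q y"
    using assms by (simp add: sorted_wrt_map_nth_less_iff)
qed

locale total_cyclic_order =
  fixes X :: "'a set" and \<pi> :: "('a \<times> 'a \<times> 'a) set"
  assumes total_cyclic_order_on: "total_cyclic_order_on X \<pi>"
begin

lemma subset_carrier: "\<pi> \<subseteq> X \<times> X \<times> X"
  and rotate: "(x, y, z) \<in> \<pi> \<Longrightarrow> (y, z, x) \<in> \<pi>"
  and asym: "(x, y, z) \<in> \<pi> \<Longrightarrow> (z, y, x) \<notin> \<pi>"
  and trans: "(x, y, z) \<in> \<pi> \<Longrightarrow> (x, z, u) \<in> \<pi> \<Longrightarrow> (x, y, u) \<in> \<pi>"
  and total: "x \<in> X \<Longrightarrow> y \<in> X \<Longrightarrow> z \<in> X \<Longrightarrow> x \<noteq> y \<Longrightarrow> y \<noteq> z \<Longrightarrow> x \<noteq> z \<Longrightarrow>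
    (x, y, z) \<in> \<pi> \<or> (z, y, x) \<in> \<pi>"
  using total_cyclic_order_on unfolding total_cyclic_order_on_def cyclic_order_on_def by blast+

lemma distinct: "(x, y, z) \<in> \<pi> \<Longrightarrow> x \<noteq> y \<and> y \<noteq> z \<and> x \<noteq> z"
  using rotate asym by metis

lemma eqI_subset:
  assumes "total_cyclic_order_on X \<sigma>" "\<sigma> \<subseteq> \<pi>"
  shows "\<sigma> = \<pi>"
proof (rule antisym[OF assms(2)], rule subsetI)
  interpret \<sigma>: total_cyclic_order X \<sigma> by unfold_locales fact
  fix u assume "u \<in> \<pi>"
  then obtain x y z where u: "u = (x, y, z)" "(x, y, z) \<in> \<pi>" by (cases u) auto
  then have "(x, y, z) \<in> \<sigma> \<or> (z, y, x) \<in> \<sigma>"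
    using \<sigma>.total distinct subset_carrier by blast
  then show "u \<in> \<sigma>"
    using u asym assms(2) by blast
qed

text \<open>The rank of \<open>y\<close> in the linear order obtained by cutting the circle just before \<open>c\<close>.\<close>

definition cut_rank :: "'a \<Rightarrow> 'a \<Rightarrow> nat" where
  "cut_rank c y = (if y = c then 0 else Suc (card {x. (c, x, y) \<in> \<pi>}))"

lemma cut_rank_less_iff:
  assumes "finite X" "c \<in> X" "y \<in> X" "z \<in> X"
  shows "cut_rank c y < cut_rank c z \<longleftrightarrow> y = c \<and> z \<noteq> c \<or> (c, y, z) \<in> \<pi>"
proof -
  have mono: "cut_rank c y < cut_rank c z" if "(c, y, z) \<in> \<pi>" for y z
  proof -
    have "finite {x. (c, x, z) \<in> \<pi>}"
      by (rule finite_subset[OF _ assms(1)]) (use subset_carrier in auto)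
    moreover have "{x. (c, x, y) \<in> \<pi>} \<subset> {x. (c, x, z) \<in> \<pi>}"
      using that trans distinct by blast
    ultimately show ?thesis
      using distinct[OF that] by (auto simp: cut_rank_def psubset_card_mono)
  qed
  consider (degenerate) "y = c \<or> z = c \<or> y = z" | (before) "(c, y, z) \<in> \<pi>" | (after) "(c, z, y) \<in> \<pi>"
    using total[OF assms(2-4)] rotate by metis
  then show ?thesis
  proof cases
    case degenerate
    then show ?thesis by (auto simp: cut_rank_def dest: distinct)
  next
    case before
    then show ?thesis using mono by blast
  next
    case after
    then show ?thesis using mono[OF after] distinct[OF after] rotate asym by (metis less_asym)
  qed
qed

lemma inj_on_cut_rank:
  assumes "finite X" "c \<in> X"
  shows "inj_on (cut_rank c) X"
proof (rule inj_onI, rule ccontr)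
  fix y z assume "y \<in> X" "z \<in> X" "cut_rank c y = cut_rank c z" "y \<noteq> z"
  then show False
    using cut_rank_less_iff[OF assms, of y z] cut_rank_less_iff[OF assms, of z y]
      total[OF assms(2), of y z] rotate by (metis less_irrefl)
qed

lemma cyclic_order_of_cut_rank:
  assumes "finite X" "c \<in> X"
  shows "cyclic_order_of X (cut_rank c) = \<pi>"
proof (rule eqI_subset[OF total_cyclic_order_on_cyclic_order_of[OF inj_on_cut_rank[OF assms]]])
  note less_iff = cut_rank_less_iff[OF assms]
  have increasing: "(x, y, z) \<in> \<pi>"
    if "cut_rank c x < cut_rank c y" "cut_rank c y < cut_rank c z" "x \<in> X" "y \<in> X" "z \<in> X" for x y z
  proof (cases "x = c")
    case True
    then show ?thesis using that by (auto simp: less_iff dest: distinct)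
  next
    case False
    then have "(c, x, y) \<in> \<pi>" "(c, y, z) \<in> \<pi>" using that by (auto simp: less_iff dest: distinct)
    then have "(y, z, x) \<in> \<pi>" by (metis rotate trans)
    then show ?thesis by (metis rotate)
  qed
  show "cyclic_order_of X (cut_rank c) \<subseteq> \<pi>"
  proof
    fix u assume "u \<in> cyclic_order_of X (cut_rank c)"
    then obtain x y z where u: "u = (x, y, z)"
      and "(x, y, z) \<in> \<pi> \<or> (y, z, x) \<in> \<pi> \<or> (z, x, y) \<in> \<pi>"
      unfolding cyclic_order_of_def using increasing by blast
    then show "u \<in> \<pi>" by (metis rotate)
  qed
qed

end

section \<open>Chains and words\<close>

lemma cyclic_chain_pair: "cyclic_chain X \<pi> [x, y] \<longleftrightarrow> x \<in> X \<and> y \<in> X \<and> x \<noteq> y"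
  by (auto simp: cyclic_chain_def)

lemma cyclic_chain_snoc:
  assumes "2 \<le> length xs"
  shows "cyclic_chain X \<pi> (xs @ [y]) \<longleftrightarrow>
    cyclic_chain X \<pi> xs \<and> y \<in> X \<and> y \<notin> set xs \<and> (hd xs, last xs, y) \<in> \<pi>"
proof -
  obtain m where m: "length xs = Suc m" "1 \<le> m" using assms by (cases xs) auto
  then have "xs \<noteq> []" by auto
  have "1 \<le> i \<and> i + 1 < length (xs @ [y]) \<longleftrightarrow> 1 \<le> i \<and> i + 1 < length xs \<or> i = m" for i
    using m by auto
  then have "(\<forall>i. 1 \<le> i \<and> i + 1 < length (xs @ [y]) \<longrightarrow>
      ((xs @ [y]) ! 0, (xs @ [y]) ! i, (xs @ [y]) ! (i + 1)) \<in> \<pi>) \<longleftrightarrow>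
    (\<forall>i. 1 \<le> i \<and> i + 1 < length xs \<longrightarrow> (xs ! 0, xs ! i, xs ! (i + 1)) \<in> \<pi>) \<and>
    (hd xs, last xs, y) \<in> \<pi>"
    using m \<open>xs \<noteq> []\<close> by (auto simp: nth_append hd_conv_nth last_conv_nth)
  then show ?thesis
    using assms by (auto simp: cyclic_chain_def)
qed

lemma cyclic_order_of_min_iff:
  assumes "c \<in> X" "y \<in> X" "z \<in> X" "p c < p y" "p c \<le> p z"
  shows "(c, y, z) \<in> cyclic_order_of X p \<longleftrightarrow> p y < p z"
  using assms by (auto simp: cyclic_order_of_def)

lemma cyclic_chain_iff_sorted:
  assumes "2 \<le> length w" "inj_on p X" "\<And>x. x \<in> X \<Longrightarrow> p (hd w) \<le> p x"
  shows "cyclic_chain X (cyclic_order_of X p) w \<longleftrightarrow> set w \<subseteq> X \<and> sorted_wrt (<) (map p w)"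
  using assms(1,3)
proof (induction w rule: rev_induct)
  case (snoc y w)
  have hd_less: "p (hd w) < p x" if "x \<in> X" "x \<noteq> hd w" "hd w \<in> X" for x
    using snoc.prems that assms(2) by (cases w) (auto simp: le_less dest: inj_onD)
  show ?case
  proof (cases "length w = 1")
    case True
    then obtain x where w: "w = [x]" by (auto simp: length_Suc_conv)
    then show ?thesis using hd_less by (auto simp: cyclic_chain_pair)
  next
    case False
    then have len: "2 \<le> length w" and "w \<noteq> []" using snoc.prems by auto
    have IH: "cyclic_chain X (cyclic_order_of X p) w \<longleftrightarrow> set w \<subseteq> X \<and> sorted_wrt (<) (map p w)"
      using snoc len \<open>w \<noteq> []\<close> by simp
    have "y \<notin> set w \<and> (hd w, last w, y) \<in> cyclic_order_of X p \<longleftrightarrow> p (last w) < p y"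
      if w: "set w \<subseteq> X" "sorted_wrt (<) (map p w)" and "y \<in> X"
    proof -
      have "hd w \<in> X" "last w \<in> X" using w(1) \<open>w \<noteq> []\<close> by auto
      moreover have "last w \<noteq> hd w"
        using w(2) len by (cases w) (auto simp: strict_sorted_iff)
      ultimately have "(hd w, last w, y) \<in> cyclic_order_of X p \<longleftrightarrow> p (last w) < p y"
        using \<open>y \<in> X\<close> hd_less snoc.prems(2) \<open>w \<noteq> []\<close> by (intro cyclic_order_of_min_iff) auto
      moreover have "p (last w) < p y \<Longrightarrow> y \<notin> set w"
        using sorted_wrt_map_le_last[OF w(2), of y] by auto
      ultimately show ?thesis by blast
    qed
    then show ?thesis
      using IH \<open>w \<noteq> []\<close> by (auto simp: cyclic_chain_snoc[OF len] sorted_wrt_snoc last_map)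
  qed
qed simp

definition is_cyclic_word :: "'a set \<Rightarrow> ('a \<times> 'a \<times> 'a) set \<Rightarrow> 'a \<Rightarrow> 'a list \<Rightarrow> bool" where
  "is_cyclic_word X \<pi> c w \<longleftrightarrow> length w = card X \<and> w ! 0 = c \<and> cyclic_chain X \<pi> w"

lemma set_is_cyclic_word:
  assumes "is_cyclic_word X \<pi> c w" "finite X"
  shows "set w = X"
  using assms by (simp add: is_cyclic_word_def cyclic_chain_def card_subset_eq distinct_card)

lemma is_cyclic_word_iff_sorted:
  assumes "finite X" "2 \<le> card X" "inj_on p X" "c \<in> X" "\<And>x. x \<in> X \<Longrightarrow> p c \<le> p x"
  shows "is_cyclic_word X (cyclic_order_of X p) c w \<longleftrightarrow> set w = X \<and> sorted_wrt (<) (map p w)"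
    (is "?L \<longleftrightarrow> ?R")
proof
  assume ?L
  then have len: "2 \<le> length w" using assms(2) by (simp add: is_cyclic_word_def)
  then have "w \<noteq> []" by auto
  then have "hd w = c" using \<open>?L\<close> by (simp add: is_cyclic_word_def hd_conv_nth)
  then show ?R
    using cyclic_chain_iff_sorted[OF len assms(3)] assms(5) \<open>?L\<close>
      set_is_cyclic_word[OF \<open>?L\<close> assms(1)] by (simp add: is_cyclic_word_def)
next
  assume ?R
  then have "distinct w" by (auto simp: strict_sorted_iff distinct_map)
  then have len: "length w = card X" using \<open>?R\<close> by (auto simp: distinct_card)
  then have "w \<noteq> []" using assms(2) by auto
  have "p (hd w) \<le> p c"
    using \<open>?R\<close> assms(4) by (cases w) auto
  then have "hd w = c"
    using assms(3-5) \<open>?R\<close> \<open>w \<noteq> []\<close> by (metis antisym hd_in_set inj_onD)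
  then show ?L
    using cyclic_chain_iff_sorted[of w p X] \<open>?R\<close> \<open>w \<noteq> []\<close> len assms
    by (simp add: is_cyclic_word_def hd_conv_nth)
qed

context total_cyclic_order
begin

lemma is_cyclic_word_iff_sorted_cut_rank:
  assumes "finite X" "2 \<le> card X" "c \<in> X"
  shows "is_cyclic_word X \<pi> c w \<longleftrightarrow> set w = X \<and> sorted_wrt (<) (map (cut_rank c) w)"
  using is_cyclic_word_iff_sorted[OF assms(1,2) inj_on_cut_rank[OF assms(1,3)] assms(3)]
  by (simp add: cyclic_order_of_cut_rank[OF assms(1,3)] cut_rank_def)

lemma ex1_cyclic_word:
  assumes "finite X" "2 \<le> card X" "c \<in> X"
  shows "\<exists>!w. is_cyclic_word X \<pi> c w"
proof -
  have sorted_iff: "is_cyclic_word X \<pi> c w \<longleftrightarrow>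
      sorted_wrt (<) (map (cut_rank c) w) \<and> set w = X \<and> length w = card X" for w
    unfolding is_cyclic_word_iff_sorted_cut_rank[OF assms]
    by (auto simp: strict_sorted_iff distinct_map distinct_card)
  interpret folding_insort_key "(\<le>)" "(<)" X "cut_rank c"
    by unfold_locales (rule inj_on_cut_rank[OF assms(1,3)])
  show ?thesis
    unfolding sorted_iff sorted_key_list_of_set_unique[OF subset_refl assms(1)] by simp
qed

lemma cyclic_order_of_eq_iff_sorted:
  assumes "finite X" "2 \<le> card X" "c \<in> X"
    and w: "is_cyclic_word X \<pi> c w"
    and q: "inj_on q X" "\<And>x. x \<in> X \<Longrightarrow> q c \<le> q x"
  shows "cyclic_order_of X q = \<pi> \<longleftrightarrow> sorted_wrt (<) (map q w)"
proof
  assume "cyclic_order_of X q = \<pi>"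
  then show "sorted_wrt (<) (map q w)"
    using is_cyclic_word_iff_sorted[OF assms(1,2) q(1) assms(3) q(2), of w] w by simp
next
  have "sorted_wrt (<) (map (cut_rank c) w)" "set w = X"
    using is_cyclic_word_iff_sorted_cut_rank[OF assms(1-3), of w] w by auto
  moreover assume "sorted_wrt (<) (map q w)"
  ultimately show "cyclic_order_of X q = \<pi>"
    using cyclic_order_of_eqI_sorted[of q w "cut_rank c"]
      cyclic_order_of_cut_rank[OF assms(1,3)] by simp
qed

end

lemma is_cyclic_word_cyclic_word:
  assumes "total_cyclic_order_on {0..n} \<pi>" "1 \<le> n"
  shows "is_cyclic_word {0..n} \<pi> 0 (cyclic_word n \<pi>)"
proof -
  interpret total_cyclic_order "{0..n}" \<pi> by unfold_locales fact
  have "cyclic_word n \<pi> = (THE w. is_cyclic_word {0..n} \<pi> 0 w)"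
    by (simp add: cyclic_word_def is_cyclic_word_def)
  then show ?thesis
    using theI'[OF ex1_cyclic_word[of 0]] assms(2) by simp
qed

section \<open>Maps sorted lexicographically by a word\<close>

definition lex_key :: "('a \<Rightarrow> 'b) \<Rightarrow> 'a \<Rightarrow> 'b \<times> 'a" where
  "lex_key f k = (f k, k)"

lemma inj_on_lex_key: "inj_on (lex_key f) X"
  by (simp add: inj_on_def lex_key_def)

definition lex_cyclic_order :: "nat \<Rightarrow> (nat \<Rightarrow> nat) \<Rightarrow> (nat \<times> nat \<times> nat) set" where
  "lex_cyclic_order n f = cyclic_order_of {0..n} (lex_key f)"

lemma total_cyclic_order_on_lex_cyclic_order: "total_cyclic_order_on {0..n} (lex_cyclic_order n f)"
  unfolding lex_cyclic_order_def by (intro total_cyclic_order_on_cyclic_order_of inj_on_lex_key)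

definition lex_sorted_maps :: "'a::linorder list \<Rightarrow> nat \<Rightarrow> ('a \<Rightarrow> nat) set" where
  "lex_sorted_maps w m =
     {f \<in> set w \<rightarrow>\<^sub>E {..<m}. f (hd w) = 0 \<and> sorted_wrt (<) (map (lex_key f) w)}"

lemma finite_lex_sorted_maps: "finite (lex_sorted_maps w m)"
  unfolding lex_sorted_maps_def by (simp add: finite_PiE)

lemma lex_sorted_maps_0: "w \<noteq> [] \<Longrightarrow> lex_sorted_maps w 0 = {}"
  by (auto simp: lex_sorted_maps_def PiE_iff)

lemma lex_sorted_maps_last_less:
  fixes w :: "'a::linorder list"
  assumes "w \<noteq> []" "b \<le> m"
  shows "{f \<in> lex_sorted_maps w m. f (last w) < b} = lex_sorted_maps w b"
proof -
  have "f x \<le> f (last w)" if "sorted_wrt (<) (map (lex_key f) w)" "x \<in> set w"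
    for f :: "'a \<Rightarrow> nat" and x
    using sorted_wrt_map_le_last[OF that] by (auto simp: lex_key_def)
  then show ?thesis
    using assms by (fastforce simp: lex_sorted_maps_def PiE_iff)
qed

lemma lex_sorted_maps_snoc:
  assumes "w \<noteq> []" "y \<notin> set w"
  shows "lex_sorted_maps (w @ [y]) m = (\<lambda>(a, f). f(y := a)) `
    (SIGMA a:{..<m}. lex_sorted_maps w (if y < last w then a else Suc a))"
proof -
  have "last w \<in> set w" "hd w \<in> set w" using assms(1) by auto
  then have neq: "last w \<noteq> y" "hd w \<noteq> y" using assms(2) by auto
  have sorted: "sorted_wrt (<) (map (lex_key (f(y := a))) (w @ [y])) \<longleftrightarrow>
      sorted_wrt (<) (map (lex_key f) w) \<and> f (last w) < (if y < last w then a else Suc a)" for f a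
  proof -
    have map_lex_key_upd: "map (lex_key (f(y := a))) w = map (lex_key f) w"
      using assms(2) by (auto simp: lex_key_def)
    show ?thesis
      using assms(1) neq by (auto simp: sorted_wrt_snoc last_map map_lex_key_upd) (auto simp: lex_key_def)
  qed
  have "lex_sorted_maps (w @ [y]) m = (\<lambda>(a, f). f(y := a)) `
      {(a, f) \<in> {..<m} \<times> (set w \<rightarrow>\<^sub>E {..<m}). f (hd w) = 0 \<and>
        sorted_wrt (<) (map (lex_key f) w) \<and> f (last w) < (if y < last w then a else Suc a)}"
    (is "_ = ?extend ` ?S")
    using assms(1) neq sorted by (auto simp: lex_sorted_maps_def PiE_insert_eq simp del: map_append)
  also have "?S = (SIGMA a:{..<m}.
      {f \<in> lex_sorted_maps w m. f (last w) < (if y < last w then a else Suc a)})"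
    by (auto simp: lex_sorted_maps_def)
  also have "\<dots> = (SIGMA a:{..<m}. lex_sorted_maps w (if y < last w then a else Suc a))"
    using assms(1) by (intro Sigma_cong refl lex_sorted_maps_last_less) auto
  finally show ?thesis .
qed

lemma card_lex_sorted_maps_snoc:
  assumes "w \<noteq> []" "y \<notin> set w"
  shows "card (lex_sorted_maps (w @ [y]) m) =
    (\<Sum>a<m. card (lex_sorted_maps w (if y < last w then a else Suc a)))"
proof -
  have "inj_on (\<lambda>(a, f). f(y := a))
      (SIGMA a:{..<m}. lex_sorted_maps w (if y < last w then a else Suc a))"
    by (rule inj_on_subset[OF inj_combinator[OF assms(2), of "\<lambda>_. UNIV"]])
      (auto simp: lex_sorted_maps_def PiE_def)
  then show ?thesis
    by (simp add: lex_sorted_maps_snoc[OF assms] card_image finite_lex_sorted_maps)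
qed

definition lex_sorted_fps :: "'a::linorder list \<Rightarrow> int fps" where
  "lex_sorted_fps w = Abs_fps (\<lambda>t. int (card (lex_sorted_maps w (Suc t))))"

lemma lex_sorted_fps_singleton: "(1 - fps_X) * lex_sorted_fps [x] = 1"
proof -
  have "lex_sorted_maps [x] (Suc t) = {(\<lambda>k. undefined)(x := 0)}" for t
    by (auto simp: lex_sorted_maps_def PiE_def extensional_def fun_eq_iff)
  then have "lex_sorted_fps [x] = Abs_fps (\<lambda>t. \<Sum>i = 0..t. fps_nth 1 i)"
    by (simp add: lex_sorted_fps_def)
  then show ?thesis
    by (simp only: fps_divide_fps_X_minus1_sum_lemma[symmetric])
qed

lemma lex_sorted_fps_snoc:
  assumes "w \<noteq> []" "y \<notin> set w"
  shows "(1 - fps_X) * lex_sorted_fps (w @ [y]) = fps_X ^ of_bool (y < last w) * lex_sorted_fps w"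
proof -
  let ?G = "fps_X ^ of_bool (y < last w) * lex_sorted_fps w"
  have coeff:
    "fps_nth ?G a = int (card (lex_sorted_maps w (if y < last w then a else Suc a)))" for a
    using assms(1) by (auto simp: lex_sorted_fps_def lex_sorted_maps_0)
  have "lex_sorted_fps (w @ [y]) = Abs_fps (\<lambda>t. \<Sum>a = 0..t. fps_nth ?G a)"
    unfolding coeff unfolding lex_sorted_fps_def card_lex_sorted_maps_snoc[OF assms]
    by (simp add: lessThan_Suc_atMost atMost_atLeast0)
  then show ?thesis
    by (simp only: fps_divide_fps_X_minus1_sum_lemma[symmetric])
qed

lemma des_snoc:
  assumes "w \<noteq> []"
  shows "des (w @ [y]) = des w + of_bool (y < last w)"
proof -
  let ?D = "\<lambda>w. {i. i + 1 < length w \<and> w ! (i + 1) < w ! i}"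
  obtain m where m: "length w = Suc m" using assms by (cases w) auto
  have "?D (w @ [y]) = ?D w \<union> (if y < last w then {m} else {})"
    using m assms by (auto simp: nth_append last_conv_nth less_Suc_eq split: if_splits)
  moreover have "m \<notin> ?D w" using m by simp
  moreover have "finite (?D w)" by (rule finite_subset[of _ "{..length w}"]) auto
  ultimately show ?thesis by (auto simp: des_def)
qed

lemma lex_sorted_fps_times_power:
  assumes "w \<noteq> []" "distinct w"
  shows "(1 - fps_X) ^ length w * lex_sorted_fps w = fps_X ^ des w"
  using assms
proof (induction w rule: rev_nonempty_induct)
  case (single x)
  then show ?case by (simp add: lex_sorted_fps_singleton des_def)
next
  case (snoc y w)
  have "(1 - fps_X) ^ length (w @ [y]) * lex_sorted_fps (w @ [y]) =
      (1 - fps_X) ^ length w * ((1 - fps_X) * lex_sorted_fps (w @ [y]))"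
    by (simp only: length_append_singleton power_Suc2 mult.assoc)
  also have "\<dots> = fps_X ^ of_bool (y < last w) * ((1 - fps_X) ^ length w * lex_sorted_fps w)"
    using snoc by (simp add: lex_sorted_fps_snoc mult.left_commute)
  also have "\<dots> = fps_X ^ des (w @ [y])"
    using snoc by (simp add: des_snoc power_add)
  finally show ?case .
qed

section \<open>Lattice points as walks on a circle\<close>

definition clockwise_dist :: "nat \<Rightarrow> nat \<Rightarrow> nat \<Rightarrow> nat" where
  "clockwise_dist m a b = (if a \<le> b then b - a else b + m - a)"

lemma clockwise_dist_less: "a < m \<Longrightarrow> b < m \<Longrightarrow> clockwise_dist m a b < m"
  by (auto simp: clockwise_dist_def)

lemma add_clockwise_dist_mod: "a < m \<Longrightarrow> b < m \<Longrightarrow> (a + clockwise_dist m a b) mod m = b"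
  by (auto simp: clockwise_dist_def)

lemma clockwise_dist_add_mod: "a < m \<Longrightarrow> d < m \<Longrightarrow> clockwise_dist m a ((a + d) mod m) = d"
  by (auto simp: clockwise_dist_def mod_if[of "a + d"])

definition circle_walks :: "nat \<Rightarrow> nat \<Rightarrow> (nat \<Rightarrow> nat) set" where
  "circle_walks n m = {f \<in> {0..n} \<rightarrow>\<^sub>E {..<m}. f 0 = 0}"

definition walk :: "nat \<Rightarrow> nat \<Rightarrow> (nat \<Rightarrow> nat) \<Rightarrow> nat \<Rightarrow> nat" where
  "walk n m x = (\<lambda>k\<in>{0..n}. (\<Sum>l=1..k. x l) mod m)"

definition steps :: "nat \<Rightarrow> nat \<Rightarrow> (nat \<Rightarrow> nat) \<Rightarrow> nat \<Rightarrow> nat" where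
  "steps n m f = (\<lambda>k\<in>{1..n}. clockwise_dist m (f (k - 1)) (f k))"

lemma finite_circle_walks: "finite (circle_walks n m)"
  unfolding circle_walks_def by (simp add: finite_PiE)

lemma clockwise_dist_walk:
  assumes "0 < m" "i \<le> j" "j \<le> n"
  shows "clockwise_dist m (walk n m x i) (walk n m x j) = (\<Sum>k=i+1..j. x k) mod m"
proof -
  have "(\<Sum>k=1..j. x k) = (\<Sum>k=1..i. x k) + (\<Sum>k=i+1..j. x k)"
    using assms(2) sum.ub_add_nat[of 1 i x "j - i"] by simp
  then have "walk n m x j = (walk n m x i + (\<Sum>k=i+1..j. x k) mod m) mod m"
    using assms by (simp add: walk_def mod_add_eq)
  then show ?thesis
    using assms by (simp add: clockwise_dist_add_mod walk_def)
qed

lemma steps_walk: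
  assumes "0 < m" "x \<in> {1..n} \<rightarrow>\<^sub>E {..<m}"
  shows "steps n m (walk n m x) = x"
proof (rule extensionalityI[of _ "{1..n}"])
  fix k assume k: "k \<in> {1..n}"
  then have "x k < m" using assms(2) by auto
  then show "steps n m (walk n m x) k = x k"
    using k clockwise_dist_walk[OF assms(1), of "k - 1" k n x] by (simp add: steps_def)
qed (use assms in \<open>auto simp: steps_def PiE_iff\<close>)

lemma walk_steps:
  assumes f: "f \<in> circle_walks n m"
  shows "walk n m (steps n m f) = f"
proof (rule extensionalityI[of _ "{0..n}"])
  have less: "f k < m" if "k \<le> n" for k
    using f that by (auto simp: circle_walks_def PiE_iff)
  have "(\<Sum>l=1..k. steps n m f l) mod m = f k" if "k \<le> n" for k
    using that
  proof (induction k)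
    case 0
    then show ?case using f by (simp add: circle_walks_def)
  next
    case (Suc k)
    have "(\<Sum>l=1..Suc k. steps n m f l) mod m =
        ((\<Sum>l=1..k. steps n m f l) mod m + steps n m f (Suc k)) mod m"
      by (simp add: mod_add_left_eq)
    also have "\<dots> = (f k + clockwise_dist m (f k) (f (Suc k))) mod m"
      using Suc by (simp add: steps_def)
    also have "\<dots> = f (Suc k)"
      using Suc.prems less by (simp add: add_clockwise_dist_mod)
    finally show ?case .
  qed
  then show "walk n m (steps n m f) k = f k" if "k \<in> {0..n}" for k
    using that by (simp add: walk_def)
qed (use f in \<open>auto simp: walk_def circle_walks_def PiE_iff\<close>)

lemma bij_betw_walk:
  assumes "0 < m"
  shows "bij_betw (walk n m) ({1..n} \<rightarrow>\<^sub>E {..<m}) (circle_walks n m)"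
proof (rule bij_betwI[where g = "steps n m"])
  show "walk n m \<in> ({1..n} \<rightarrow>\<^sub>E {..<m}) \<rightarrow> circle_walks n m"
    using assms by (auto simp: circle_walks_def walk_def)
  show "steps n m \<in> circle_walks n m \<rightarrow> ({1..n} \<rightarrow>\<^sub>E {..<m})"
    by (auto simp: circle_walks_def steps_def PiE_iff intro!: clockwise_dist_less)
qed (simp_all add: assms steps_walk walk_steps)

lemma lex_cyclic_order_iff_clockwise_dist:
  fixes f :: "nat \<Rightarrow> nat"
  assumes "i < j" "j < k" "k \<le> n" "f i < m" "f j < m" "f k < m"
  shows "(i, j, k) \<in> lex_cyclic_order n f \<longleftrightarrow>
    clockwise_dist m (f i) (f j) + clockwise_dist m (f j) (f k) < m"
  using assms
  by (auto simp: lex_cyclic_order_def cyclic_order_of_def lex_key_def clockwise_dist_def)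

lemma cyclic_chain_walk_iff:
  assumes x: "x \<in> {1..n} \<rightarrow>\<^sub>E {..<m}" and "i < j" "j \<le> n"
  shows "cyclic_chain {0..n} (lex_cyclic_order n (walk n m x)) [i..<j + 1] \<longleftrightarrow>
    (\<Sum>k=i+1..j. x k) < m"
  using Suc_leI[OF assms(2)] assms(3)
proof (induction j rule: dec_induct)
  case base
  then have "x (Suc i) < m" using x by (auto simp: PiE_iff)
  then show ?case using base by (auto simp: cyclic_chain_pair upt_rec)
next
  case (step j)
  let ?f = "walk n m x"
  have bounds: "i < j" "Suc j \<le> n" using step by auto
  have "x (Suc j) < m" using x bounds by (auto simp: PiE_iff)
  then have "0 < m" by simp
  have less: "?f k < m" if "k \<le> n" for k
    using that \<open>0 < m\<close> by (simp add: walk_def)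
  have "[i..<Suc j + 1] = [i..<j + 1] @ [Suc j]" using bounds by simp
  then have "cyclic_chain {0..n} (lex_cyclic_order n ?f) [i..<Suc j + 1] \<longleftrightarrow>
      (\<Sum>k=i+1..j. x k) < m \<and> (i, j, Suc j) \<in> lex_cyclic_order n ?f"
    using step.IH bounds cyclic_chain_snoc[of "[i..<j + 1]" "{0..n}" _ "Suc j"] by auto
  also have "\<dots> \<longleftrightarrow> (\<Sum>k=i+1..j. x k) < m \<and> (\<Sum>k=i+1..j. x k) mod m + x (Suc j) < m"
    using bounds less clockwise_dist_walk[OF \<open>0 < m\<close>, of i j n x]
      clockwise_dist_walk[OF \<open>0 < m\<close>, of j "Suc j" n x] \<open>x (Suc j) < m\<close>
    by (simp add: lex_cyclic_order_iff_clockwise_dist[where m = m])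
  also have "\<dots> \<longleftrightarrow> (\<Sum>k=i+1..Suc j. x k) < m" using bounds by auto
  finally show ?case .
qed

lemma walk_in_cyclic_orders_A_iff:
  assumes "x \<in> {1..n} \<rightarrow>\<^sub>E {..<m}" "I \<subseteq> index_pairs n"
  shows "lex_cyclic_order n (walk n m x) \<in> cyclic_orders_A I n \<longleftrightarrow>
    (\<forall>(i, j)\<in>I. (\<Sum>k=i+1..j. x k) < m)"
proof -
  have "cyclic_chain {0..n} (lex_cyclic_order n (walk n m x)) [i..<j + 1] \<longleftrightarrow>
      (\<Sum>k=i+1..j. x k) < m" if "(i, j) \<in> I" for i j
    using assms that by (intro cyclic_chain_walk_iff) (auto simp: index_pairs_def)
  then show ?thesis
    using total_cyclic_order_on_lex_cyclic_order unfolding cyclic_orders_A_def by blast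
qed

section \<open>Lattice points of the dilated polytope\<close>

lemma dilate_polytope_B:
  assumes "I \<subseteq> index_pairs n"
  shows "dilate n t (polytope_B I n) =
    {y \<in> {1..n} \<rightarrow>\<^sub>E {0..real t}. \<forall>(i, j)\<in>I. (\<Sum>k=i+1..j. y k) \<le> real t}" (is "?L = ?R")
proof
  have scale: "(\<Sum>k=i+1..j. (\<lambda>k\<in>{1..n}. c * x k) k) = c * (\<Sum>k=i+1..j. x k)"
    if "(i, j) \<in> I" for i j c and x :: "nat \<Rightarrow> real"
    unfolding sum_distrib_left using assms that by (intro sum.cong) (auto simp: index_pairs_def)
  show "?L \<subseteq> ?R"
  proof
    fix y assume "y \<in> ?L"
    then obtain x where x: "x \<in> polytope_B I n" and y: "y = (\<lambda>k\<in>{1..n}. real t * x k)"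
      by (auto simp: dilate_def)
    have "(\<Sum>k=i+1..j. y k) \<le> real t" if "(i, j) \<in> I" for i j
      unfolding y scale[OF that] using x that by (intro mult_left_le) (auto simp: polytope_B_def)
    moreover have "y \<in> {1..n} \<rightarrow>\<^sub>E {0..real t}"
      using x by (auto simp: y polytope_B_def PiE_iff intro!: mult_left_le)
    ultimately show "y \<in> ?R" by auto
  qed
  show "?R \<subseteq> ?L"
  proof
    fix y assume y: "y \<in> ?R"
    \<comment> \<open>For \<open>t = 0\<close> this is the origin, since division by zero yields zero.\<close>
    define x where "x = (\<lambda>k\<in>{1..n}. (1 / real t) * y k)"
    have "(\<Sum>k=i+1..j. x k) \<le> 1" if "(i, j) \<in> I" for i j
      unfolding x_def scale[OF that] using y that by (auto simp: divide_le_eq_1)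
    moreover have "x \<in> {1..n} \<rightarrow>\<^sub>E {0..1}"
      using y by (auto simp: x_def PiE_iff divide_le_eq_1)
    ultimately have "x \<in> polytope_B I n" by (auto simp: polytope_B_def)
    moreover have "y = (\<lambda>k\<in>{1..n}. real t * x k)"
    proof (rule extensionalityI[of _ "{1..n}"])
      fix k assume k: "k \<in> {1..n}"
      then have "y k \<in> {0..real t}" using y by auto
      then show "y k = (\<lambda>k\<in>{1..n}. real t * x k) k" using k by (cases "t = 0") (auto simp: x_def)
    qed (use y in \<open>auto simp: PiE_iff\<close>)
    ultimately show "y \<in> ?L" by (auto simp: dilate_def)
  qed
qed

lemma bij_betw_real_PiE:
  "bij_betw (\<lambda>x. \<lambda>k\<in>K. real (x k)) (K \<rightarrow>\<^sub>E {..t}) (K \<rightarrow>\<^sub>E {0..real t} \<inter> \<int>)"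
proof (rule bij_betwI[where g = "\<lambda>y. \<lambda>k\<in>K. nat \<lfloor>y k\<rfloor>"])
  have real_floor: "real (nat \<lfloor>r\<rfloor>) = r" if "r \<in> {0..real t} \<inter> \<int>" for r :: real
    using that by (auto elim: Ints_cases)
  show "(\<lambda>k\<in>K. real ((\<lambda>k\<in>K. nat \<lfloor>y k\<rfloor>) k)) = y" if "y \<in> K \<rightarrow>\<^sub>E {0..real t} \<inter> \<int>" for y
    using that real_floor by (intro extensionalityI[of _ K]) (auto simp: PiE_iff)
  have "nat \<lfloor>r\<rfloor> \<in> {..t}" if "r \<in> {0..real t} \<inter> \<int>" for r :: real
    using real_floor[OF that] that by auto
  then show "(\<lambda>y. \<lambda>k\<in>K. nat \<lfloor>y k\<rfloor>) \<in> (K \<rightarrow>\<^sub>E {0..real t} \<inter> \<int>) \<rightarrow> (K \<rightarrow>\<^sub>E {..t})"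
    by (simp add: PiE_iff)
  show "(\<lambda>k\<in>K. nat \<lfloor>(\<lambda>k\<in>K. real (x k)) k\<rfloor>) = x" if "x \<in> K \<rightarrow>\<^sub>E {..t}" for x
    using that by (intro extensionalityI[of _ K]) (auto simp: PiE_iff)
qed (auto simp: PiE_iff)

lemma ehrhart_polytope_B:
  assumes "I \<subseteq> index_pairs n"
  shows "ehrhart n (polytope_B I n) t =
    card {x \<in> {1..n} \<rightarrow>\<^sub>E {..t}. \<forall>(i, j)\<in>I. (\<Sum>k=i+1..j. x k) \<le> t}" (is "_ = card ?N")
proof -
  let ?real = "\<lambda>x. \<lambda>k\<in>{1..n}. real (x k)"
  have "(\<Sum>k=i+1..j. ?real x k) = real (\<Sum>k=i+1..j. x k)" if "(i, j) \<in> I" for i j x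
    unfolding of_nat_sum using assms that by (intro sum.cong) (auto simp: index_pairs_def)
  then have "(\<forall>(i, j)\<in>I. (\<Sum>k=i+1..j. ?real x k) \<le> real t) \<longleftrightarrow>
      (\<forall>(i, j)\<in>I. (\<Sum>k=i+1..j. x k) \<le> t)" for x
    by (metis (mono_tags, lifting) of_nat_le_iff case_prodI2 case_prodD)
  then have "bij_betw ?real ?N
      {y \<in> {1..n} \<rightarrow>\<^sub>E {0..real t} \<inter> \<int>. \<forall>(i, j)\<in>I. (\<Sum>k=i+1..j. y k) \<le> real t}"
    by (intro bij_betw_Collect[OF bij_betw_real_PiE])
  also have "{y \<in> {1..n} \<rightarrow>\<^sub>E {0..real t} \<inter> \<int>. \<forall>(i, j)\<in>I. (\<Sum>k=i+1..j. y k) \<le> real t} =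
      dilate n t (polytope_B I n) \<inter> ({1..n} \<rightarrow>\<^sub>E \<int>)"
    unfolding dilate_polytope_B[OF assms] PiE_Int[symmetric] by blast
  finally show ?thesis
    unfolding ehrhart_def by (rule bij_betw_same_card[symmetric])
qed

section \<open>The Ehrhart series\<close>

lemma circle_walks_with_lex_cyclic_order:
  assumes "total_cyclic_order_on {0..n} \<pi>" "1 \<le> n"
  shows "{f \<in> circle_walks n m. lex_cyclic_order n f = \<pi>} =
    lex_sorted_maps (cyclic_word n \<pi>) m"
proof -
  interpret total_cyclic_order "{0..n}" \<pi> by unfold_locales fact
  let ?w = "cyclic_word n \<pi>"
  have w: "is_cyclic_word {0..n} \<pi> 0 ?w" by (rule is_cyclic_word_cyclic_word[OF assms])
  then have "set ?w = {0..n}"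
    by (rule set_is_cyclic_word) simp
  moreover have "hd ?w = 0"
    using w by (cases ?w) (auto simp: is_cyclic_word_def)
  moreover have "lex_cyclic_order n f = \<pi> \<longleftrightarrow> sorted_wrt (<) (map (lex_key f) ?w)"
    if "f 0 = 0" for f :: "nat \<Rightarrow> nat"
    unfolding lex_cyclic_order_def using w that assms(2)
    by (intro cyclic_order_of_eq_iff_sorted[of 0] inj_on_lex_key) (auto simp: lex_key_def)
  ultimately show ?thesis
    by (auto simp: circle_walks_def lex_sorted_maps_def)
qed

lemma finite_cyclic_orders_A: "finite (cyclic_orders_A I n)"
proof (rule finite_subset)
  show "cyclic_orders_A I n \<subseteq> Pow ({0..n} \<times> {0..n} \<times> {0..n})"
    unfolding cyclic_orders_A_def total_cyclic_order_on_def cyclic_order_on_def by blast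
qed simp

lemma ehrhart_polytope_B_eq_sum:
  assumes "1 \<le> n" "I \<subseteq> index_pairs n"
  shows "ehrhart n (polytope_B I n) t =
    (\<Sum>\<pi>\<in>cyclic_orders_A I n. card (lex_sorted_maps (cyclic_word n \<pi>) (Suc t)))"
proof -
  let ?A = "cyclic_orders_A I n" and ?W = "circle_walks n (Suc t)"
  have "ehrhart n (polytope_B I n) t =
      card {x \<in> {1..n} \<rightarrow>\<^sub>E {..<Suc t}. lex_cyclic_order n (walk n (Suc t) x) \<in> ?A}"
    unfolding ehrhart_polytope_B[OF assms(2)]
      lessThan_Suc_atMost[symmetric] less_Suc_eq_le[symmetric]
    using walk_in_cyclic_orders_A_iff[OF _ assms(2)] by (intro arg_cong[where f = card]) blast
  also have "\<dots> = card {f \<in> ?W. lex_cyclic_order n f \<in> ?A}"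
    by (intro bij_betw_same_card[where f = "walk n (Suc t)"] bij_betw_Collect bij_betw_walk) auto
  also have "{f \<in> ?W. lex_cyclic_order n f \<in> ?A} = (\<Union>\<pi>\<in>?A. {f \<in> ?W. lex_cyclic_order n f = \<pi>})"
    by auto
  also have "card \<dots> = (\<Sum>\<pi>\<in>?A. card {f \<in> ?W. lex_cyclic_order n f = \<pi>})"
    by (rule card_UN_disjoint) (auto simp: finite_cyclic_orders_A finite_circle_walks)
  also have "\<dots> = (\<Sum>\<pi>\<in>?A. card (lex_sorted_maps (cyclic_word n \<pi>) (Suc t)))"
    using assms(1) by (intro sum.cong arg_cong[where f = card] circle_walks_with_lex_cyclic_order)
      (auto simp: cyclic_orders_A_def)
  finally show ?thesis .
qed

lemma lex_sorted_fps_cyclic_word: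
  assumes "total_cyclic_order_on {0..n} \<pi>" "1 \<le> n"
  shows "(1 - fps_X) ^ (n + 1) * lex_sorted_fps (cyclic_word n \<pi>) = fps_X ^ des (cyclic_word n \<pi>)"
proof -
  have len: "length (cyclic_word n \<pi>) = n + 1" and "distinct (cyclic_word n \<pi>)"
    using is_cyclic_word_cyclic_word[OF assms] by (auto simp: is_cyclic_word_def cyclic_chain_def)
  moreover from len have "cyclic_word n \<pi> \<noteq> []" by auto
  ultimately show ?thesis using lex_sorted_fps_times_power[of "cyclic_word n \<pi>"] by simp
qed

theorem theorem2p9:
  fixes n :: nat and I :: "(nat \<times> nat) set"
  assumes "n \<ge> 1" and "I \<subseteq> index_pairs n"
  shows "ehrhart_hstar n (polytope_B I n) = (\<Sum>\<pi>\<in>cyclic_orders_A I n. fps_X ^ des (cyclic_word n \<pi>))"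
proof -
  have "Abs_fps (\<lambda>t. int (ehrhart n (polytope_B I n) t)) =
      (\<Sum>\<pi>\<in>cyclic_orders_A I n. lex_sorted_fps (cyclic_word n \<pi>))"
    by (simp add: fps_eq_iff fps_sum_nth lex_sorted_fps_def ehrhart_polytope_B_eq_sum[OF assms])
  then have "ehrhart_hstar n (polytope_B I n) =
      (\<Sum>\<pi>\<in>cyclic_orders_A I n. (1 - fps_X) ^ (n + 1) * lex_sorted_fps (cyclic_word n \<pi>))"
    by (simp add: ehrhart_hstar_def sum_distrib_left)
  also have "\<dots> = (\<Sum>\<pi>\<in>cyclic_orders_A I n. fps_X ^ des (cyclic_word n \<pi>))"
    using assms(1) by (intro sum.cong refl lex_sorted_fps_cyclic_word)
      (auto simp: cyclic_orders_A_def)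
  finally show ?thesis .
qed

end
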